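(* Let $N=\{1,\ldots,n\}$ and let $C \subset \mathbb{Z}^n$ be a bounded integral hole-free set. The following statements are equivalent: (1) $C$ has a least $(1,b)$-majorized element for each $b \in \mathbb{Z}^n$; (2) for each $b \in \mathbb{Z}^n$, there exists $x^* \in C$ that is an optimal solution to $\min_{x \in C} \Phi(x+b)$ for any choice of continuous Schur-convex function $\Phi:\mathbb{R}^n\to\mathbb{R}$; (3) the function $f(A) := \max_{x \in C} x(A)$, $A\subseteq N$, is integral and submodular and $C = B^{\mathbb{Z}}(f)$.
   Context: Notation: $x(A) := \sum_{i\in A} x_i$ for $x\in\mathbb{R}^n$, $A\subseteq N$; in "$(1,b)$", $1$ is the all-ones vector. "Integral" means integer-valued. A set $C\subseteq\mathbb{Z}^n$ is hole-free if $C=\mathrm{co}(C)\cap\mathbb{Z}^n$, where $\mathrm{co}$ denotes convex hull. $(1,b)$-majorization: $x$ is $(1,b)$-majorized by $y$ if $x(N)=y(N)$ and $\sum_{i\in N}\phi(x_i+b_i)\le \sum_{i\in N}\phi(y_i+b_i)$ for all continuous convex functions $\phi:\mathbb{R}\to\mathbb{R}$. A vector $x\in C$ is a least $(1,b)$-majorized element of $C$ if $x$ is $(1,b)$-majorized by every $y\in C$. Schur-convexity: let $x^{\downarrow}$ denote the rearrangement of $x$ in non-increasing order; $x\prec y$ if $\sum_{i=1}^k x^{\downarrow}_i\le\sum_{i=1}^k y^{\downarrow}_i$ for all $k\in N$ and $x(N)=y(N)$. $\Phi:\mathbb{R}^n\to\mathbb{R}$ is Schur-convex if $x\prec y$ implies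 $\Phi(x)\le\Phi(y)$. Submodularity: $f:2^N\to\mathbb{R}$ with $f(\emptyset)=0$ is submodular if $f(A)+f(B)\ge f(A\cup B)+f(A\cap B)$ for all $A,B\subseteq N$. The integral base polyhedron is $B^{\mathbb{Z}}(f):=\{x\in\mathbb{Z}^n: x(A)\le f(A)\ \forall A\subseteq N,\ x(N)=f(N)\}$. *)

theory Defs
  imports "HOL-Analysis.Analysis" "HOL-Library.Multiset"
begin

text \<open>
  The ground set \<open>N\<close> is the set of all elements of a finite index type \<open>'n\<close>, so \<open>n = CARD('n)\<close>,
  and the integer lattice is treated as a subset of \<open>real ^ 'n\<close>.
\<close>

definition int_lattice :: "(real ^ 'n::finite) set" where
  "int_lattice = {x. \<forall>i. x $ i \<in> \<int>}"

definition vsum :: "real ^ 'n::finite \<Rightarrow> 'n set \<Rightarrow> real" where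
  "vsum x A = (\<Sum>i\<in>A. x $ i)"

definition hole_free :: "(real ^ 'n::finite) set \<Rightarrow> bool" where
  "hole_free C \<longleftrightarrow> C = convex hull C \<inter> int_lattice"

text \<open>\<open>one_majorized b x y\<close>: \<open>x\<close> is \<open>(1,b)\<close>-majorized by \<open>y\<close>.\<close>

definition one_majorized ::
    "real ^ 'n::finite \<Rightarrow> real ^ 'n \<Rightarrow> real ^ 'n \<Rightarrow> bool" where
  "one_majorized b x y \<longleftrightarrow>
     vsum x UNIV = vsum y UNIV \<and>
     (\<forall>\<phi> :: real \<Rightarrow> real. continuous_on UNIV \<phi> \<and> convex_on UNIV \<phi> \<longrightarrow>
        (\<Sum>i\<in>UNIV. \<phi> (x $ i + b $ i)) \<le> (\<Sum>i\<in>UNIV. \<phi> (y $ i + b $ i)))"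

definition least_one_majorized ::
    "real ^ 'n::finite \<Rightarrow> (real ^ 'n) set \<Rightarrow> real ^ 'n \<Rightarrow> bool" where
  "least_one_majorized b C x \<longleftrightarrow> x \<in> C \<and> (\<forall>y\<in>C. one_majorized b x y)"

text \<open>The entries of \<open>x\<close>, with multiplicity, in non-increasing order.\<close>

definition dec_rearrangement :: "real ^ 'n::finite \<Rightarrow> real list" where
  "dec_rearrangement x =
     rev (sorted_list_of_multiset (image_mset (\<lambda>i. x $ i) (mset_set UNIV)))"

definition majorized :: "real ^ 'n::finite \<Rightarrow> real ^ 'n \<Rightarrow> bool" where
  "majorized x y \<longleftrightarrow>
     (\<forall>k\<in>{1..CARD('n)}.
        sum_list (take k (dec_rearrangement x)) \<le> sum_list (take k (dec_rearrangement y))) \<and>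
     vsum x UNIV = vsum y UNIV"

definition schur_convex :: "(real ^ 'n::finite \<Rightarrow> real) \<Rightarrow> bool" where
  "schur_convex \<Phi> \<longleftrightarrow> (\<forall>x y. majorized x y \<longrightarrow> \<Phi> x \<le> \<Phi> y)"

definition submodular :: "('n::finite set \<Rightarrow> real) \<Rightarrow> bool" where
  "submodular f \<longleftrightarrow>
     f {} = 0 \<and> (\<forall>A B. f A + f B \<ge> f (A \<union> B) + f (A \<inter> B))"

definition integral_base_polyhedron :: "('n::finite set \<Rightarrow> real) \<Rightarrow> (real ^ 'n) set" where
  "integral_base_polyhedron f =
     {x \<in> int_lattice. (\<forall>A. vsum x A \<le> f A) \<and> vsum x UNIV = f UNIV}"

text \<open>
  Below, \<open>C\<close> is a bounded set of lattice points, hence finite, so \<open>Max\<close> is the true maximum as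
  soon as \<open>C\<close> is nonempty.  For empty \<open>C\<close> the function is constant.
\<close>

definition support_fun :: "(real ^ 'n::finite) set \<Rightarrow> 'n set \<Rightarrow> real" where
  "support_fun C A = Max ((\<lambda>x. vsum x A) ` C)"

end

theory Submission
  imports Defs
begin

text \<open>
  For (1) implies (3), very steep shifts \<open>b\<close> force the least element to attain the support function
  on all members of a prescribed chain of sets simultaneously.  Chains of length two give
  submodularity; full chains say that the greedy vectors lie in \<open>C\<close>, so that no linear functional
  separates a point of the base polyhedron from \<open>convex hull C\<close>.
  For (3) implies (2), the element minimising the sum of squares of \<open>x + b\<close> is majorized by all
  others, as sets that are tight for it certify every hinge inequality.
  For (2) implies (1), sums of convex functions are Schur-convex (Karamata).
\<close>

text \<open>Abel summation without an ordering of \<open>I\<close>: \<open>w\<close> is its minimum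
  plus a nonnegative combination of indicators of its superlevel sets. The constant pairs to zero
  with \<open>d\<close> and each indicator pairs nonnegatively.\<close>

lemma sum_mult_nonneg_by_level_sets:
  fixes w d :: "'a \<Rightarrow> real"
  assumes "finite I" and tot: "sum d I = 0"
    and lev: "\<And>s. sum d {i\<in>I. w i \<ge> s} \<ge> 0"
  shows "(\<Sum>i\<in>I. w i * d i) \<ge> 0"
proof -
  have nonneg_case: "(\<Sum>i\<in>I. v i * d i) \<ge> 0"
    if "\<And>i. i \<in> I \<Longrightarrow> v i \<ge> 0" and "\<And>s. s > 0 \<Longrightarrow> sum d {i\<in>I. v i \<ge> s} \<ge> 0" for v
    using that
  proof (induction "card {i\<in>I. v i > 0}" arbitrary: v rule: less_induct)
    case less
    define P where "P = {i\<in>I. v i > 0}"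
    have finP: "finite P" using \<open>finite I\<close> by (simp add: P_def)
    show ?case
    proof (cases "P = {}")
      case True
      then have "v i = 0" if "i \<in> I" for i
        using less.prems(1)[OF that] that by (force simp: P_def)
      then show ?thesis by simp
    next
      case False
      \<comment> \<open>Peeling off \<open>m\<close> times the indicator of the positive support
        \<open>P\<close> makes at least one further value vanish, so the induction measure
        drops.\<close>
      define m where "m = Min (v ` P)"
      have "m \<in> v ` P" unfolding m_def using False finP by (intro Min_in) auto
      then obtain k where k: "k \<in> P" "v k = m" by blast
      have m0: "m > 0" using k by (simp add: P_def)
      have mle: "m \<le> v i" if "i \<in> P" for i
        unfolding m_def using that finP by simp
      define v' where "v' i = (if i \<in> P then v i - m else v i)" for i
      have z: "v i = 0" if "i \<in> I" "i \<notin> P" for i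
        using less.prems(1)[OF that(1)] that by (auto simp: P_def)
      have "{i\<in>I. v' i > 0} \<subset> P"
        using k z by (auto simp: v'_def P_def split: if_splits)
      then have c: "card {i\<in>I. v' i > 0} < card {i\<in>I. v i > 0}"
        using finP psubset_card_mono unfolding P_def by blast
      \<comment> \<open>The hypothesis on level sets passes to \<open>v'\<close>, as its positive
        levels are those of \<open>v\<close> shifted by \<open>m\<close>.\<close>
      have "{i\<in>I. v' i \<ge> s} = {i\<in>I. v i \<ge> s + m}" if "s > 0" for s
        using that m0 z by (force simp: v'_def P_def)
      then have IH: "(\<Sum>i\<in>I. v' i * d i) \<ge> 0"
        using less.prems(2) m0 mle less.prems(1)
        by (intro less.hyps[OF c]) (auto simp: v'_def)
      have "P = {i\<in>I. v i \<ge> m}" using mle m0 by (auto simp: P_def)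
      then have "sum d P \<ge> 0" using less.prems(2)[OF m0] by simp
      moreover have "(\<Sum>i\<in>I. v i * d i) = (\<Sum>i\<in>I. v' i * d i) + m * sum d P"
      proof -
        have "m * sum d P = (\<Sum>i\<in>I. if i \<in> P then m * d i else 0)"
          using \<open>finite I\<close> by (auto simp: sum_distrib_left P_def sum.inter_filter intro!: sum.cong)
        then show ?thesis
          by (simp add: sum.distrib[symmetric] v'_def) (rule sum.cong, auto simp: algebra_simps)
      qed
      ultimately show ?thesis using IH m0 by simp
    qed
  qed
  show ?thesis
  proof (cases "I = {}")
    case False
    define m where "m = Min (w ` I)"
    have "(\<Sum>i\<in>I. (w i - m) * d i) \<ge> 0"
    proof (rule nonneg_case)
      show "w i - m \<ge> 0" if "i \<in> I" for i using that \<open>finite I\<close> by (simp add: m_def)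
      show "sum d {i\<in>I. w i - m \<ge> s} \<ge> 0" for s
        using lev[of "s + m"] by (simp add: algebra_simps)
    qed
    also have "(\<Sum>i\<in>I. (w i - m) * d i) = (\<Sum>i\<in>I. w i * d i) - m * sum d I"
      by (simp add: algebra_simps sum_subtractf sum_distrib_left)
    finally show ?thesis using tot by simp
  qed simp
qed

section \<open>Decreasing rearrangements and a hinge criterion for majorization\<close>

lemma mset_dec_rearrangement: "mset (dec_rearrangement x) = image_mset (($) x) (mset_set UNIV)"
  by (simp add: dec_rearrangement_def)

lemma length_dec_rearrangement [simp]:
  fixes x :: "real ^ 'n::finite"
  shows "length (dec_rearrangement x) = CARD('n)"
  using arg_cong[OF mset_dec_rearrangement, of size x] by simp

lemma set_dec_rearrangement: "set (dec_rearrangement x) = range (($) x)"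
  using arg_cong[OF mset_dec_rearrangement, of set_mset x] by simp

lemma dec_rearrangement_antimono:
  "i \<le> j \<Longrightarrow> j < length (dec_rearrangement x) \<Longrightarrow> dec_rearrangement x ! j \<le> dec_rearrangement x ! i"
proof -
  have "sorted (rev (dec_rearrangement x))" by (simp add: dec_rearrangement_def)
  then show "i \<le> j \<Longrightarrow> j < length (dec_rearrangement x) \<Longrightarrow> ?thesis"
    using sorted_rev_nth_mono by blast
qed

lemma sum_dec_rearrangement:
  fixes x :: "real ^ 'n::finite" and h :: "real \<Rightarrow> 'b::comm_monoid_add"
  shows "(\<Sum>j<CARD('n). h (dec_rearrangement x ! j)) = (\<Sum>i\<in>UNIV. h (x $ i))"
proof -
  have "(\<Sum>j<CARD('n). h (dec_rearrangement x ! j)) = sum_list (map h (dec_rearrangement x))"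
    by (simp add: sum_list_sum_nth atLeast0LessThan)
  also have "\<dots> = sum_mset (mset (map h (dec_rearrangement x)))"
    by (simp only: sum_mset_sum_list)
  also have "\<dots> = (\<Sum>i\<in>UNIV. h (x $ i))"
    by (simp add: mset_dec_rearrangement image_mset.compositionality o_def sum_unfold_sum_mset)
  finally show ?thesis .
qed

lemma sum_list_take_dec_rearrangement:
  fixes x :: "real ^ 'n::finite"
  assumes "k \<le> CARD('n)"
  shows "sum_list (take k (dec_rearrangement x)) = (\<Sum>j<k. dec_rearrangement x ! j)"
  using assms by (simp add: sum_list_sum_nth atLeast0LessThan)

text \<open>If \<open>t\<close> is the k-th largest entry of \<open>y\<close>, the hinge sum of
  \<open>y\<close> at \<open>t\<close> equals the sum of its k largest entries minus
  \<open>k * t\<close>, whereas for \<open>x\<close> it is at least that difference. Hence kinks at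
  entries of \<open>y\<close> suffice; they are integers when \<open>y\<close> is a lattice
  point.\<close>

lemma majorizedI_hinge:
  fixes x y :: "real ^ 'n::finite"
  assumes tot: "vsum x UNIV = vsum y UNIV"
    and hinge: "\<And>j. (\<Sum>i\<in>UNIV. max 0 (x $ i - y $ j)) \<le> (\<Sum>i\<in>UNIV. max 0 (y $ i - y $ j))"
  shows "majorized x y"
  unfolding majorized_def
proof (intro conjI ballI)
  fix k assume k: "k \<in> {1..CARD('n)}"
  define X where "X = dec_rearrangement x"
  define Y where "Y = dec_rearrangement y"
  \<comment> \<open>List positions start at zero, so this is the k-th largest entry.\<close>
  define t where "t = Y ! (k - 1)"
  have "t \<in> set Y" using k unfolding t_def by (intro nth_mem) (auto simp: Y_def)
  then obtain j where j: "t = y $ j" by (auto simp: Y_def set_dec_rearrangement)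
  have split: "{..<CARD('n)} = {..<k} \<union> {k..<CARD('n)}" using k by auto
  have "(\<Sum>j<k. X ! j) - k * t = (\<Sum>j<k. X ! j - t)" by (simp add: sum_subtractf)
  also have "\<dots> \<le> (\<Sum>j<k. max 0 (X ! j - t))" by (intro sum_mono) simp
  also have "\<dots> \<le> (\<Sum>j<CARD('n). max 0 (X ! j - t))"
    using k by (intro sum_mono2) auto
  also have "\<dots> \<le> (\<Sum>j<CARD('n). max 0 (Y ! j - t))"
    using hinge[of j] sum_dec_rearrangement[of "\<lambda>a. max 0 (a - t)" x]
      sum_dec_rearrangement[of "\<lambda>a. max 0 (a - t)" y]
    by (simp add: X_def Y_def j)
  also have "\<dots> = (\<Sum>j<k. max 0 (Y ! j - t)) + (\<Sum>j=k..<CARD('n). max 0 (Y ! j - t))"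
    unfolding split by (rule sum.union_disjoint) auto
  also have "(\<Sum>j<k. max 0 (Y ! j - t)) = (\<Sum>j<k. Y ! j - t)"
    using k dec_rearrangement_antimono[of _ "k - 1" y]
    by (intro sum.cong) (auto simp: t_def Y_def)
  also have "(\<Sum>j=k..<CARD('n). max 0 (Y ! j - t)) = 0"
    using k dec_rearrangement_antimono[of "k - 1" _ y]
    by (intro sum.neutral) (auto simp: t_def Y_def)
  finally have "(\<Sum>j<k. X ! j) \<le> (\<Sum>j<k. Y ! j)" by (simp add: sum_subtractf)
  then show "sum_list (take k (dec_rearrangement x)) \<le> sum_list (take k (dec_rearrangement y))"
    using k by (simp add: sum_list_take_dec_rearrangement X_def Y_def)
qed (fact tot)

section \<open>Karamata's inequality\<close>

lemma convex_on_subgradient: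
  fixes \<phi> :: "real \<Rightarrow> real"
  assumes "convex_on UNIV \<phi>"
  obtains g where "mono g" and "\<And>u v. \<phi> v \<ge> \<phi> u + g u * (v - u)"
proof
  \<comment> \<open>The right derivative. Monotonicity comes from adding the subgradient
    inequalities at \<open>u\<close> and at \<open>v\<close>.\<close>
  define g where "g u = Inf ((\<lambda>t. (\<phi> u - \<phi> t) / (u - t)) ` {u<..})" for u
  show *: "\<phi> v \<ge> \<phi> u + g u * (v - u)" for u v
    using convex_le_Inf_differential[OF assms, of u v] by (simp add: g_def)
  show "mono g"
  proof (rule monoI)
    fix u v :: real assume "u \<le> v"
    have "(g v - g u) * (v - u) \<ge> 0"
      using *[of u v] *[of v u] by (simp add: algebra_simps)
    then show "g u \<le> g v"
      using \<open>u \<le> v\<close> by (cases "u = v") (auto simp: zero_le_mult_iff)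
  qed
qed

text \<open>Subgradients at the sorted entries of \<open>x\<close> bound the difference of the two
  sums below by a sum weighted with \<open>g (X ! j)\<close>. These weights do not increase with
  \<open>j\<close>, so their level sets are initial segments, on which majorization controls
  \<open>Y - X\<close>.\<close>

lemma schur_convex_sum_convex:
  fixes \<phi> :: "real \<Rightarrow> real"
  assumes "convex_on UNIV \<phi>"
  shows "schur_convex (\<lambda>z :: real ^ 'n::finite. \<Sum>i\<in>UNIV. \<phi> (z $ i))"
  unfolding schur_convex_def
proof (intro allI impI)
  fix x y :: "real ^ 'n" assume maj: "majorized x y"
  obtain g where g: "mono g" "\<And>u v. \<phi> v \<ge> \<phi> u + g u * (v - u)"
    using convex_on_subgradient[OF assms] by blast
  define X where "X = dec_rearrangement x"
  define Y where "Y = dec_rearrangement y"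
  define n where "n = CARD('n)"
  have len: "length X = n" "length Y = n" by (simp_all add: X_def Y_def n_def)
  have part: "(\<Sum>j<k. Y ! j - X ! j) \<ge> 0" if "k \<le> n" for k
  \<comment> \<open>\<open>majorized\<close> speaks of positive \<open>k\<close> only, but a level
    set may be empty.\<close>
  proof (cases "k = 0")
    case False
    then show ?thesis
      using maj that unfolding majorized_def
      by (auto simp: sum_list_take_dec_rearrangement X_def Y_def n_def sum_subtractf
            dest!: bspec[of _ _ k])
  qed simp
  have "(\<Sum>j<n. g (X ! j) * (Y ! j - X ! j)) \<ge> 0"
  proof (rule sum_mult_nonneg_by_level_sets)
    show "(\<Sum>j<n. Y ! j - X ! j) = 0"
      using maj sum_dec_rearrangement[of "\<lambda>a. a" x] sum_dec_rearrangement[of "\<lambda>a. a" y]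
      by (simp add: majorized_def vsum_def sum_subtractf X_def Y_def n_def)
    fix s
    define S where "S = {j\<in>{..<n}. g (X ! j) \<ge> s}"
    have down: "i \<in> S" if "j \<in> S" "i \<le> j" for i j
    proof -
      have "X ! j \<le> X ! i"
        using that len dec_rearrangement_antimono[of i j x] by (auto simp: S_def X_def)
      then show ?thesis using that monoD[OF g(1)] by (force simp: S_def)
    qed
    have fin: "finite S" by (simp add: S_def)
    have "S = {..<card S}"
    proof (cases "S = {}")
      case False
      then have "Max S \<in> S" using fin by simp
      then have "S = {..Max S}" using down[of "Max S"] fin by auto
      then show ?thesis by (metis card_atMost lessThan_Suc_atMost)
    qed simp
    moreover have "card S \<le> n" using card_mono[of "{..<n}" S] by (auto simp: S_def)
    ultimately show "(\<Sum>j\<in>{j\<in>{..<n}. g (X ! j) \<ge> s}. Y ! j - X ! j) \<ge> 0"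
      using part[of "card S"] by (simp add: S_def)
  qed simp
  also have "\<dots> \<le> (\<Sum>j<n. \<phi> (Y ! j) - \<phi> (X ! j))"
  proof (rule sum_mono)
    show "g (X ! j) * (Y ! j - X ! j) \<le> \<phi> (Y ! j) - \<phi> (X ! j)" for j
      using g(2)[of "X ! j" "Y ! j"] by simp
  qed
  finally show "(\<Sum>i\<in>UNIV. \<phi> (x $ i)) \<le> (\<Sum>i\<in>UNIV. \<phi> (y $ i))"
    by (simp add: sum_subtractf X_def Y_def n_def sum_dec_rearrangement)
qed

section \<open>Support functions of finite sets of lattice points, and (1) implies (3)\<close>

lemma vsum_add: "vsum (x + y) A = vsum x A + vsum y A"
  by (simp add: vsum_def sum.distrib)

lemma vsum_Un_Int: "vsum x (A \<union> B) + vsum x (A \<inter> B) = vsum x A + vsum x B"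
  unfolding vsum_def by (rule sum.union_inter) auto

lemma finite_bounded_int_lattice:
  fixes C :: "(real ^ 'n::finite) set"
  assumes "C \<subseteq> int_lattice" "bounded C"
  shows "finite C"
proof -
  obtain K where K: "\<And>x. x \<in> C \<Longrightarrow> norm x \<le> K"
    using \<open>bounded C\<close> by (auto simp: bounded_iff)
  define S where "S = {r :: real. r \<in> \<int> \<and> \<bar>r\<bar> \<le> K}"
  have "finite S" unfolding S_def by (rule finite_abs_int_segment)
  then have "finite (Pi\<^sub>E (UNIV :: 'n set) (\<lambda>_. S))" by (intro finite_PiE) auto
  moreover have "($) ` C \<subseteq> Pi\<^sub>E UNIV (\<lambda>_. S)"
    using assms(1) K by (auto simp: S_def int_lattice_def intro: norm_bound_component_le_cart)
  ultimately have "finite (($) ` C)" by (rule finite_subset[rotated])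
  then show ?thesis by (rule finite_imageD) (simp add: inj_on_def vec_nth_inject)
qed

lemma vsum_le_support_fun: "finite C \<Longrightarrow> x \<in> C \<Longrightarrow> vsum x A \<le> support_fun C A"
  by (simp add: support_fun_def)

lemma support_fun_attained:
  assumes "finite C" "C \<noteq> {}"
  obtains x where "x \<in> C" "support_fun C A = vsum x A"
proof -
  have "support_fun C A \<in> (\<lambda>x. vsum x A) ` C"
    unfolding support_fun_def using assms by (intro Max_in) auto
  then show ?thesis using that by blast
qed

lemma vsum_in_Ints: "x \<in> int_lattice \<Longrightarrow> vsum x A \<in> \<int>"
  unfolding vsum_def by (intro Ints_sum) (simp add: int_lattice_def)

text \<open>A steep shift \<open>b = M r\<close> separates the levels of \<open>r\<close> so widely that the order of the levels
  in \<open>x + b\<close> no longer depends on \<open>x\<close>; hinges with kinks between the levels then measure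
  \<open>x\<close> on each superlevel set.\<close>

lemma least_one_majorized_attains_on_chain:
  fixes C :: "(real ^ 'n::finite) set" and r :: "'n \<Rightarrow> int"
  assumes "bounded C" and least: "\<forall>b\<in>int_lattice. \<exists>x. least_one_majorized b C x"
  obtains x where "x \<in> C" "\<And>m y. y \<in> C \<Longrightarrow> vsum y {i. r i \<le> m} \<le> vsum x {i. r i \<le> m}"
proof -
  obtain K where K: "\<And>x. x \<in> C \<Longrightarrow> norm x \<le> K"
    using \<open>bounded C\<close> by (auto simp: bounded_iff)
  \<comment> \<open>Coordinates of members of \<open>C\<close> are at most \<open>M / 2\<close> in
    absolute value. Rounding up keeps \<open>b\<close> integral, and \<open>\<bar>K\<bar>\<close>
    keeps \<open>M\<close> nonnegative even for empty \<open>C\<close>.\<close>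
  define M where "M = \<lceil>2 * \<bar>K\<bar>\<rceil>"
  have M: "2 * \<bar>K\<bar> \<le> M" by (simp add: M_def)
  have M0: "real_of_int M \<ge> 0" using M by linarith
  define b :: "real ^ 'n" where "b = (\<chi> i. of_int (M * r i))"
  have "b \<in> int_lattice" by (simp add: b_def int_lattice_def)
  then obtain x where x: "x \<in> C" "\<And>y. y \<in> C \<Longrightarrow> one_majorized b x y"
    using least by (auto simp: least_one_majorized_def)
  have "vsum y {i. r i \<le> m} \<le> vsum x {i. r i \<le> m}" if y: "y \<in> C" for y m
  proof -
    \<comment> \<open>The midpoint between levels \<open>M * m\<close> and
      \<open>M * (m + 1)\<close> of \<open>b\<close>: a perturbation by at most \<open>M / 2\<close>
      cannot cross it, so the hinge sum is affine on \<open>C\<close>.\<close>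
    define t where "t = of_int M * of_int m + real_of_int M / 2"
    define U where "U = {i. r i > m}"
    have hinge: "(\<Sum>i\<in>UNIV. max 0 (z $ i + b $ i - t)) = vsum z U + (\<Sum>i\<in>U. b $ i - t)"
      if z: "z \<in> C" for z
    proof -
      have zi: "\<bar>z $ i\<bar> \<le> M / 2" for i
        using component_le_norm_cart[of z i] K[OF z] M by linarith
      have "max 0 (z $ i + b $ i - t) = (if i \<in> U then z $ i + (b $ i - t) else 0)" for i
      proof (cases "i \<in> U")
        case True
        then have "real_of_int M * (real_of_int m + 1) \<le> real_of_int M * real_of_int (r i)"
          using M0 by (intro mult_left_mono) (auto simp: U_def)
        then show ?thesis using True zi[of i] by (simp add: b_def t_def algebra_simps)
      next
        case False
        then have "real_of_int M * real_of_int (r i) \<le> real_of_int M * real_of_int m"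
          using M0 by (intro mult_left_mono) (auto simp: U_def)
        then show ?thesis using False zi[of i] by (simp add: b_def t_def)
      qed
      then show ?thesis by (simp add: vsum_def sum.distrib flip: sum.inter_restrict)
    qed
    have "continuous_on UNIV (\<lambda>u. max 0 (u - t))" by (intro continuous_intros)
    moreover have "convex_on UNIV (\<lambda>u. max 0 (u - t))"
    proof (intro convex_onI)
      fix s u v :: real assume s: "0 < s" "s < 1"
      have "(1 - s) * (u - t) \<le> (1 - s) * max 0 (u - t)" "s * (v - t) \<le> s * max 0 (v - t)"
        "0 \<le> (1 - s) * max 0 (u - t)" "0 \<le> s * max 0 (v - t)"
        using s by (auto intro!: mult_left_mono)
      then show "max 0 ((1 - s) *\<^sub>R u + s *\<^sub>R v - t) \<le> (1 - s) * max 0 (u - t) + s * max 0 (v - t)"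
        by (intro max.boundedI) (simp_all add: algebra_simps)
    qed simp
    ultimately have "(\<Sum>i\<in>UNIV. max 0 (x $ i + b $ i - t)) \<le> (\<Sum>i\<in>UNIV. max 0 (y $ i + b $ i - t))"
      using x(2)[OF y] spec[of _ "\<lambda>u. max 0 (u - t)"] unfolding one_majorized_def by blast
    then have U: "vsum x U \<le> vsum y U" using hinge x(1) y by simp
    \<comment> \<open>The hinge makes \<open>x\<close> minimal on the superlevel set
      \<open>U\<close>; as totals agree, \<open>x\<close> is maximal on the complement.\<close>
    have "vsum z {i. r i \<le> m} + vsum z U = vsum z UNIV" for z :: "real ^ 'n"
    proof -
      have "{i. r i \<le> m} \<union> U = UNIV" "{i. r i \<le> m} \<inter> U = {}" by (auto simp: U_def)
      then show ?thesis using vsum_Un_Int[of z "{i. r i \<le> m}" U] by (simp add: vsum_def)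
    qed
    then show ?thesis using U x(2)[OF y] unfolding one_majorized_def by (smt (verit))
  qed
  then show ?thesis using that x(1) by blast
qed

text \<open>One \<open>x\<close> attains the support function on both members of the chain formed by
  the intersection and the union. Since \<open>vsum x\<close> is modular, the two values add up to
  \<open>vsum x A + vsum x B\<close>.\<close>

lemma submodular_support_fun:
  fixes C :: "(real ^ 'n::finite) set"
  assumes "finite C" "C \<noteq> {}"
    and chain: "\<And>r :: 'n \<Rightarrow> int. \<exists>x\<in>C. \<forall>m. \<forall>y\<in>C. vsum y {i. r i \<le> m} \<le> vsum x {i. r i \<le> m}"
  shows "submodular (support_fun C)"
  unfolding submodular_def
proof (intro conjI allI)
  show "support_fun C {} = 0"
    using support_fun_attained[OF assms(1,2), of "{}"] by (auto simp: vsum_def)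
  fix A B :: "'n set"
  define r :: "'n \<Rightarrow> int" where "r i = (if i \<in> A \<inter> B then 0 else if i \<in> A \<union> B then 1 else 2)" for i
  obtain x where x: "x \<in> C" "\<And>m y. y \<in> C \<Longrightarrow> vsum y {i. r i \<le> m} \<le> vsum x {i. r i \<le> m}"
    using chain[of r] by blast
  have "{i. r i \<le> 0} = A \<inter> B" "{i. r i \<le> 1} = A \<union> B" by (auto simp: r_def)
  then have "support_fun C (A \<inter> B) \<le> vsum x (A \<inter> B)" "support_fun C (A \<union> B) \<le> vsum x (A \<union> B)"
    using x(2)[of _ 0] x(2)[of _ 1] support_fun_attained[OF assms(1,2)] by metis+
  then show "support_fun C A + support_fun C B \<ge> support_fun C (A \<union> B) + support_fun C (A \<inter> B)"
    using vsum_Un_Int[of x A B] vsum_le_support_fun[OF assms(1) x(1)] by (smt (verit))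
qed

text \<open>A point \<open>y\<close> outside the hull is strictly separated from \<open>C\<close> by
  some functional. The greedy vector for that functional lies in \<open>C\<close> by
  \<open>chain\<close> and does at least as well as \<open>y\<close>, which contradicts the
  separation.\<close>

lemma integral_base_polyhedron_subset_convex_hull:
  fixes C :: "(real ^ 'n::finite) set"
  assumes "finite C" "C \<noteq> {}"
    and tot: "\<And>x y. x \<in> C \<Longrightarrow> y \<in> C \<Longrightarrow> vsum x UNIV = vsum y UNIV"
    and chain: "\<And>r :: 'n \<Rightarrow> int. \<exists>x\<in>C. \<forall>m. \<forall>y\<in>C. vsum y {i. r i \<le> m} \<le> vsum x {i. r i \<le> m}"
  shows "integral_base_polyhedron (support_fun C) \<subseteq> convex hull C"
proof (rule subsetI, rule ccontr)
  fix y assume y: "y \<in> integral_base_polyhedron (support_fun C)" and "y \<notin> convex hull C"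
  moreover have "closed (convex hull C)"
    using \<open>finite C\<close> by (simp add: compact_imp_closed finite_imp_compact_convex_hull)
  ultimately obtain a c where sep: "inner a y < c" "\<And>x. x \<in> convex hull C \<Longrightarrow> inner a x > c"
    using separating_hyperplane_closed_point[of "convex hull C" y] convex_convex_hull by blast
  \<comment> \<open>Separation puts \<open>C\<close> on the side of large \<open>inner a\<close>,
    whereas the support function bounds sums from above; hence the sign.\<close>
  define w where "w i = - a $ i" for i
  \<comment> \<open>Integer ranks replace the real weights: sublevel sets of \<open>r\<close> are
    superlevel sets of \<open>w\<close>, with ties preserved.\<close>
  define r where "r i = int (card {j. w j > w i})" for i
  obtain x where x: "x \<in> C" "\<And>m z. z \<in> C \<Longrightarrow> vsum z {i. r i \<le> m} \<le> vsum x {i. r i \<le> m}"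
    using chain[of r] by blast
  have r_iff: "r i \<le> r k \<longleftrightarrow> w k \<le> w i" for i k
  proof (cases "w k \<le> w i")
    case True
    then have "card {j. w j > w i} \<le> card {j. w j > w k}" by (intro card_mono) auto
    then show ?thesis using True by (simp add: r_def)
  next
    case False
    then have "{j. w j > w k} \<subseteq> {j. w j > w i}" "k \<in> {j. w j > w i} - {j. w j > w k}" by auto
    then have "{j. w j > w k} \<subset> {j. w j > w i}" by blast
    then have "card {j. w j > w k} < card {j. w j > w i}" by (simp add: psubset_card_mono)
    then show ?thesis using False by (simp add: r_def)
  qed
  have "(\<Sum>i\<in>UNIV. w i * (x $ i - y $ i)) \<ge> 0"
  proof (rule sum_mult_nonneg_by_level_sets)
    have "vsum y UNIV = support_fun C UNIV" using y by (simp add: integral_base_polyhedron_def)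
    also have "\<dots> = vsum x UNIV" using support_fun_attained[OF assms(1,2)] tot x(1) by metis
    finally show "(\<Sum>i\<in>UNIV. x $ i - y $ i) = 0" by (simp add: sum_subtractf vsum_def)
    fix s
    define S where "S = {i. w i \<ge> s}"
    have "vsum y S \<le> vsum x S"
    proof (cases "S = {}")
      case False
      then have "Min (w ` S) \<in> w ` S" by (intro Min_in) auto
      then obtain k where k: "k \<in> S" "w k = Min (w ` S)" by force
      have "w k \<le> w i" if "i \<in> S" for i using that by (simp add: k(2))
      \<comment> \<open>A nonempty superlevel set is cut off exactly at the least weight occurring
        in it, so it belongs to the chain of \<open>r\<close>.\<close>
      then have "S = {i. w k \<le> w i}" using k(1) by (auto simp: S_def)
      then have S: "S = {i. r i \<le> r k}" by (simp add: r_iff)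
      have "vsum y S \<le> support_fun C S" using y by (simp add: integral_base_polyhedron_def)
      also have "\<dots> \<le> vsum x S" using support_fun_attained[OF assms(1,2)] x(2) S by metis
      finally show ?thesis .
    qed (simp add: vsum_def)
    then show "(\<Sum>i\<in>{i\<in>UNIV. w i \<ge> s}. x $ i - y $ i) \<ge> 0"
      by (simp add: S_def vsum_def sum_subtractf)
  qed simp
  then have "inner a x \<le> inner a y"
    by (simp add: w_def inner_vec_def algebra_simps sum.distrib sum_subtractf sum_negf)
  then show False using sep(1) sep(2)[of x] x(1) hull_inc[of x C] by fastforce
qed

section \<open>Tight sets and exchanges in the base polyhedron: (3) implies (2)\<close>

definition tight :: "('n::finite set \<Rightarrow> real) \<Rightarrow> real ^ 'n \<Rightarrow> 'n set \<Rightarrow> bool" where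
  "tight f x A \<longleftrightarrow> vsum x A = f A"

text \<open>Uncrossing: \<open>vsum x\<close> is modular, \<open>f\<close> is submodular and
  dominates \<open>vsum x\<close>, so equality at \<open>A\<close> and \<open>B\<close> forces
  equality at the union and the intersection.\<close>

lemma tight_Un_Int:
  assumes "submodular f" "x \<in> integral_base_polyhedron f" "tight f x A" "tight f x B"
  shows "tight f x (A \<union> B)" "tight f x (A \<inter> B)"
proof -
  have "f A + f B \<ge> f (A \<union> B) + f (A \<inter> B)" using assms(1) by (simp add: submodular_def)
  moreover have "vsum x (A \<union> B) \<le> f (A \<union> B)" "vsum x (A \<inter> B) \<le> f (A \<inter> B)"
    using assms(2) by (auto simp: integral_base_polyhedron_def)
  ultimately show "tight f x (A \<union> B)" "tight f x (A \<inter> B)"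
    using vsum_Un_Int[of x A B] assms(3,4) by (auto simp: tight_def)
qed

lemma tight_UN:
  assumes "submodular f" "x \<in> integral_base_polyhedron f" "finite I" "\<And>i. i \<in> I \<Longrightarrow> tight f x (A i)"
  shows "tight f x (\<Union>i\<in>I. A i)"
  using assms(3,4)
proof (induction I rule: finite_induct)
  case empty
  then show ?case using assms(1) by (simp add: tight_def submodular_def vsum_def)
next
  case (insert i I)
  then show ?case using tight_Un_Int(1)[OF assms(1,2), of "A i" "\<Union>i\<in>I. A i"] by simp
qed

lemma tight_INT:
  assumes "submodular f" "x \<in> integral_base_polyhedron f" "finite I" "\<And>i. i \<in> I \<Longrightarrow> tight f x (A i)"
  shows "tight f x (\<Inter>i\<in>I. A i)"
  using assms(3,4)
proof (induction I rule: finite_induct)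
  \<comment> \<open>The empty intersection is \<open>UNIV\<close>, tight by the constraint on the
    total. It arises when no coordinate lies above the kink.\<close>
  case empty
  then show ?case using assms(2) by (simp add: tight_def integral_base_polyhedron_def)
next
  case (insert i I)
  then show ?case using tight_Un_Int(2)[OF assms(1,2), of "A i" "\<Inter>i\<in>I. A i"] by simp
qed

lemma vsum_exchange:
  fixes x :: "real ^ 'n::finite"
  shows "vsum (x + axis i 1 - axis j 1) A = vsum x A + of_bool (i \<in> A) - of_bool (j \<in> A)"
proof -
  have "vsum (axis k 1) A = of_bool (k \<in> A)" for k :: 'n
    by (simp add: vsum_def axis_def)
  moreover have "vsum (x + axis i 1 - axis j 1) A = vsum x A + vsum (axis i 1) A - vsum (axis j 1) A"
    by (simp add: vsum_def sum.distrib sum_subtractf)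
  ultimately show ?thesis by simp
qed

text \<open>Moving one unit from \<open>j\<close> to \<open>i\<close> raises \<open>vsum x A\<close>
  only if \<open>A\<close> contains \<open>i\<close> but not \<open>j\<close>, and then by one. A
  constraint violated afterwards had slack below one before, hence zero by integrality.\<close>

lemma exchange_blocked_by_tight_set:
  fixes x :: "real ^ 'n::finite"
  assumes f: "\<And>A. f A \<in> \<int>" and x: "x \<in> integral_base_polyhedron f"
    and z: "x + axis i 1 - axis j 1 \<notin> integral_base_polyhedron f"
  obtains A where "tight f x A" "i \<in> A" "j \<notin> A"
proof -
  have xl: "x \<in> int_lattice" using x by (simp add: integral_base_polyhedron_def)
  then have "x + axis i 1 - axis j 1 \<in> int_lattice" by (simp add: int_lattice_def axis_def)
  moreover have "vsum (x + axis i 1 - axis j 1) UNIV = f UNIV"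
    using x by (simp add: vsum_exchange integral_base_polyhedron_def)
  ultimately obtain A where A: "vsum (x + axis i 1 - axis j 1) A > f A"
    using z by (auto simp: integral_base_polyhedron_def not_le)
  have le: "vsum x A \<le> f A" using x by (simp add: integral_base_polyhedron_def)
  have ij: "i \<in> A" "j \<notin> A" using A le by (cases "i \<in> A"; cases "j \<in> A"; simp add: vsum_exchange)+
  have "f A - vsum x A \<in> \<int>" using f vsum_in_Ints[OF xl] by simp
  moreover have "\<bar>f A - vsum x A\<bar> < 1" using A le ij by (simp add: vsum_exchange)
  ultimately have "f A - vsum x A = 0" using Ints_nonzero_abs_less1 by blast
  then have "tight f x A" by (simp add: tight_def)
  then show ?thesis using that ij by blast
qed

lemma sum_squares_exchange:
  fixes x b :: "real ^ 'n::finite"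
  assumes "i \<noteq> j"
  shows "(\<Sum>k\<in>UNIV. ((x + axis i 1 - axis j 1) $ k + b $ k)\<^sup>2)
       = (\<Sum>k\<in>UNIV. (x $ k + b $ k)\<^sup>2) + 2 * (x $ i + b $ i) - 2 * (x $ j + b $ j) + 2"
proof -
  have "((x + axis i 1 - axis j 1) $ k + b $ k)\<^sup>2 = (x $ k + b $ k)\<^sup>2
      + (if k = i then 2 * (x $ i + b $ i) + 1 else 0) + (if k = j then 1 - 2 * (x $ j + b $ j) else 0)"
    for k
    using assms by (auto simp: axis_def power2_eq_square algebra_simps)
  then show ?thesis by (simp add: sum.distrib)
qed

text \<open>At a minimiser of the square sum no unit can be moved from a coordinate above \<open>t\<close> to one
  below \<open>t\<close>; the tight sets blocking these moves combine to a tight set that contains all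
  coordinates below \<open>t\<close> and none above.\<close>

lemma square_minimizer_hinge_le:
  fixes x b :: "real ^ 'n::finite"
  assumes f: "\<And>A. f A \<in> \<int>" "submodular f" and b: "b \<in> int_lattice"
    and x: "x \<in> integral_base_polyhedron f"
    and min: "\<And>y. y \<in> integral_base_polyhedron f \<Longrightarrow>
      (\<Sum>k\<in>UNIV. (x $ k + b $ k)\<^sup>2) \<le> (\<Sum>k\<in>UNIV. (y $ k + b $ k)\<^sup>2)"
    and y: "y \<in> integral_base_polyhedron f" and t: "t \<in> \<int>"
  shows "(\<Sum>i\<in>UNIV. max 0 (x $ i + b $ i - t)) \<le> (\<Sum>i\<in>UNIV. max 0 (y $ i + b $ i - t))"
proof -
  define L where "L = {i. x $ i + b $ i < t}"
  define U where "U = {i. x $ i + b $ i > t}"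
  have int: "x $ i + b $ i \<in> \<int>" for i
    using x b by (simp add: integral_base_polyhedron_def int_lattice_def)
  have "\<exists>A. tight f x A \<and> i \<in> A \<and> j \<notin> A" if "i \<in> L" "j \<in> U" for i j
  proof -
    \<comment> \<open>By integrality the two entries differ by at least two, so the exchange would
      lower the square sum by at least two.\<close>
    have "x $ i + b $ i \<le> t - 1" "x $ j + b $ j \<ge> t + 1"
      using that int[of i] int[of j] t by (auto simp: L_def U_def elim!: Ints_cases)
    then have "x + axis i 1 - axis j 1 \<notin> integral_base_polyhedron f"
      using min[of "x + axis i 1 - axis j 1"] sum_squares_exchange[of i j x b] by fastforce
    then show ?thesis using exchange_blocked_by_tight_set[OF f(1) x] by metis
  qed
  then obtain A where A: "\<And>i j. i \<in> L \<Longrightarrow> j \<in> U \<Longrightarrow> tight f x (A i j) \<and> i \<in> A i j \<and> j \<notin> A i j"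
    by metis
  \<comment> \<open>For fixed \<open>i\<close> the intersection keeps \<open>i\<close> and avoids
    all of \<open>U\<close>; the union over \<open>i\<close> then covers \<open>L\<close> and still
    avoids \<open>U\<close>.\<close>
  define T where "T = (\<Union>i\<in>L. \<Inter>j\<in>U. A i j)"
  have "tight f x T"
    unfolding T_def by (intro tight_UN[OF f(2) x] tight_INT[OF f(2) x]) (auto simp: A)
  then have "vsum y T \<le> vsum x T" using y by (auto simp: tight_def integral_base_polyhedron_def)
  moreover have "vsum z T + vsum z (-T) = vsum z UNIV" for z :: "real ^ 'n"
    using vsum_Un_Int[of z T "-T"] by (simp add: vsum_def)
  moreover have "vsum x UNIV = vsum y UNIV" using x y by (simp add: integral_base_polyhedron_def)
  ultimately have co: "vsum x (-T) \<le> vsum y (-T)" by (smt (verit))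
  have "L \<subseteq> T" "T \<inter> U = {}" using A by (force simp: T_def)+
  \<comment> \<open>Entries on \<open>-T\<close> are at least \<open>t\<close> and those on
    \<open>T\<close> at most \<open>t\<close>; entries equal to \<open>t\<close> contribute zero on
    either side.\<close>
  have "max 0 (x $ i + b $ i - t) = (if i \<in> -T then x $ i + b $ i - t else 0)" for i
    using \<open>L \<subseteq> T\<close> \<open>T \<inter> U = {}\<close> by (force simp: L_def U_def)
  then have "(\<Sum>i\<in>UNIV. max 0 (x $ i + b $ i - t)) = (\<Sum>i\<in>-T. x $ i + b $ i - t)"
    by (simp add: sum.If_cases Compl_eq)
  also have "\<dots> \<le> (\<Sum>i\<in>-T. y $ i + b $ i - t)"
    using co by (simp add: vsum_def sum.distrib sum_subtractf)
  also have "\<dots> \<le> (\<Sum>i\<in>-T. max 0 (y $ i + b $ i - t))" by (intro sum_mono) simp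
  also have "\<dots> \<le> (\<Sum>i\<in>UNIV. max 0 (y $ i + b $ i - t))" by (intro sum_mono2) auto
  finally show ?thesis .
qed

text \<open>The minimiser of the square sum is chosen before \<open>y\<close> and the kink, so a
  single \<open>x\<close> satisfies the hinge inequalities against every \<open>y\<close>.\<close>

lemma integral_base_polyhedron_has_least_majorized:
  fixes f :: "'n::finite set \<Rightarrow> real"
  assumes f: "\<And>A. f A \<in> \<int>" "submodular f" and b: "b \<in> int_lattice"
    and "finite (integral_base_polyhedron f)" "integral_base_polyhedron f \<noteq> {}"
  obtains x where "x \<in> integral_base_polyhedron f"
    "\<And>y. y \<in> integral_base_polyhedron f \<Longrightarrow> majorized (x + b) (y + b)"
proof -
  define q where "q x = (\<Sum>k\<in>UNIV. (x $ k + b $ k)\<^sup>2)" for x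
  obtain x where x: "x \<in> integral_base_polyhedron f"
    "\<And>y. y \<in> integral_base_polyhedron f \<Longrightarrow> q x \<le> q y"
    using ex_min_if_finite[of "q ` integral_base_polyhedron f"] assms(4,5)
    by (auto simp: not_less)
  have "majorized (x + b) (y + b)" if y: "y \<in> integral_base_polyhedron f" for y
  proof (rule majorizedI_hinge)
    show "vsum (x + b) UNIV = vsum (y + b) UNIV"
      using x(1) y by (simp add: vsum_add integral_base_polyhedron_def)
    show "(\<Sum>i\<in>UNIV. max 0 ((x + b) $ i - (y + b) $ j))
        \<le> (\<Sum>i\<in>UNIV. max 0 ((y + b) $ i - (y + b) $ j))" for j
    proof -
      have "(y + b) $ j \<in> \<int>" using y b by (simp add: integral_base_polyhedron_def int_lattice_def)
      then show ?thesis
        using square_minimizer_hinge_le[OF f b x(1) x(2)[unfolded q_def] y] by simp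
    qed
  qed
  then show ?thesis using that x(1) by blast
qed

section \<open>The cycle (1) to (3) to (2) to (1)\<close>

theorem theorem6:
  fixes C :: "(real ^ 'n::finite) set"
  assumes "C \<subseteq> int_lattice" and "bounded C" and "hole_free C"
  defines "S1 \<equiv> (\<forall>b\<in>int_lattice. \<exists>x. least_one_majorized b C x)"
    and "S2 \<equiv> (\<forall>b\<in>int_lattice. \<exists>x\<in>C. \<forall>\<Phi> :: real ^ 'n \<Rightarrow> real.
                 continuous_on UNIV \<Phi> \<and> schur_convex \<Phi> \<longrightarrow> (\<forall>y\<in>C. \<Phi> (x + b) \<le> \<Phi> (y + b)))"
    and "S3 \<equiv> ((\<forall>A. support_fun C A \<in> \<int>) \<and> submodular (support_fun C) \<and>
               C = integral_base_polyhedron (support_fun C))"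
  shows "(S1 \<longleftrightarrow> S2) \<and> (S2 \<longleftrightarrow> S3)"
proof -
  have fin: "finite C" using finite_bounded_int_lattice assms(1,2) by blast
  have "S3" if S1
  proof -
    have least: "\<forall>b\<in>int_lattice. \<exists>x. least_one_majorized b C x" using that by (simp add: S1_def)
    \<comment> \<open>The shift zero already shows that \<open>C\<close> is nonempty and that all
      its members have the same total.\<close>
    moreover have "0 \<in> int_lattice" by (simp add: int_lattice_def)
    ultimately obtain x0 where x0: "least_one_majorized 0 C x0" by blast
    then have ne: "C \<noteq> {}" by (auto simp: least_one_majorized_def)
    have tot: "vsum x UNIV = vsum y UNIV" if "x \<in> C" "y \<in> C" for x y
      using x0 that unfolding least_one_majorized_def one_majorized_def by metis
    have chain: "\<exists>x\<in>C. \<forall>m. \<forall>y\<in>C. vsum y {i. r i \<le> m} \<le> vsum x {i. r i \<le> m}" for r :: "'n \<Rightarrow> int"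
      by (rule least_one_majorized_attains_on_chain[OF assms(2) least, of r]) blast
    have int: "support_fun C A \<in> \<int>" for A
      by (rule support_fun_attained[OF fin ne, of A]) (use vsum_in_Ints assms(1) in auto)
    have "C \<subseteq> integral_base_polyhedron (support_fun C)"
    proof
      fix x assume "x \<in> C"
      moreover have "support_fun C UNIV = vsum x UNIV"
        using support_fun_attained[OF fin ne] tot \<open>x \<in> C\<close> by metis
      ultimately show "x \<in> integral_base_polyhedron (support_fun C)"
        using vsum_le_support_fun[OF fin] assms(1) by (auto simp: integral_base_polyhedron_def)
    qed
    moreover have "integral_base_polyhedron (support_fun C) \<subseteq> C"
    proof -
      have "integral_base_polyhedron (support_fun C) \<subseteq> convex hull C \<inter> int_lattice"
        using integral_base_polyhedron_subset_convex_hull[OF fin ne tot chain]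
        by (auto simp: integral_base_polyhedron_def)
      then show ?thesis using assms(3) unfolding hole_free_def by blast
    qed
    ultimately show S3
      unfolding S3_def using int submodular_support_fun[OF fin ne chain] by blast
  qed
  moreover have S2 if S3
  proof -
    have int: "\<And>A. support_fun C A \<in> \<int>" and sub: "submodular (support_fun C)"
      and C: "C = integral_base_polyhedron (support_fun C)"
      using that unfolding S3_def by blast+
    \<comment> \<open>For empty \<open>C\<close> the support function is constant, hence zero by its
      value at \<open>{}\<close>. Then the zero vector lies in the base polyhedron, which is
      supposed to equal \<open>C\<close>.\<close>
    have ne: "C \<noteq> {}"
    proof
      assume "C = {}"
      then have "support_fun C A = support_fun C {}" for A by (simp add: support_fun_def)
      then have "support_fun C A = 0" for A using sub by (simp add: submodular_def)
      then have "0 \<in> integral_base_polyhedron (support_fun C)"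
        by (simp add: integral_base_polyhedron_def int_lattice_def vsum_def)
      then show False using C \<open>C = {}\<close> by blast
    qed
    show S2
      unfolding S2_def
    proof
      fix b :: "real ^ 'n" assume "b \<in> int_lattice"
      then obtain x where "x \<in> C" "\<And>y. y \<in> C \<Longrightarrow> majorized (x + b) (y + b)"
        using integral_base_polyhedron_has_least_majorized[OF int sub] fin ne C by metis
      then show "\<exists>x\<in>C. \<forall>\<Phi> :: real ^ 'n \<Rightarrow> real.
          continuous_on UNIV \<Phi> \<and> schur_convex \<Phi> \<longrightarrow> (\<forall>y\<in>C. \<Phi> (x + b) \<le> \<Phi> (y + b))"
        unfolding schur_convex_def by blast
    qed
  qed
  moreover have S1 if s2: S2
    unfolding S1_def
  proof
    fix b :: "real ^ 'n" assume "b \<in> int_lattice"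
    then obtain x where x: "x \<in> C"
      and opt: "\<And>\<Phi> y. continuous_on UNIV \<Phi> \<Longrightarrow> schur_convex \<Phi> \<Longrightarrow> y \<in> C \<Longrightarrow> \<Phi> (x + b) \<le> \<Phi> (y + b)"
      using s2 unfolding S2_def by blast
    have convex_opt: "(\<Sum>i\<in>UNIV. \<phi> (x $ i + b $ i)) \<le> (\<Sum>i\<in>UNIV. \<phi> (y $ i + b $ i))"
      if "y \<in> C" "continuous_on UNIV \<phi>" "convex_on UNIV \<phi>" for y and \<phi> :: "real \<Rightarrow> real"
    proof -
      have "continuous_on UNIV (\<lambda>z :: real ^ 'n. \<Sum>i\<in>UNIV. \<phi> (z $ i))"
        by (intro continuous_on_sum continuous_on_compose2[OF that(2)] continuous_intros) auto
      from opt[OF this schur_convex_sum_convex[OF that(3)] that(1)] show ?thesis by simp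
    qed
    have "vsum x UNIV = vsum y UNIV" if "y \<in> C" for y
    proof -
      \<comment> \<open>The identity and its negative are both convex, which pins down the
        total.\<close>
      have "(\<Sum>i\<in>UNIV. x $ i + b $ i) \<le> (\<Sum>i\<in>UNIV. y $ i + b $ i)"
        using that by (intro convex_opt) (auto simp: convex_on_def)
      moreover have "(\<Sum>i\<in>UNIV. - (x $ i + b $ i)) \<le> (\<Sum>i\<in>UNIV. - (y $ i + b $ i))"
        using that by (intro convex_opt continuous_intros) (auto simp: convex_on_def)
      ultimately show ?thesis by (simp add: vsum_def sum.distrib sum_negf sum_subtractf)
    qed
    then have "least_one_majorized b C x"
      using x convex_opt by (simp add: least_one_majorized_def one_majorized_def)
    then show "\<exists>x. least_one_majorized b C x" ..
  qed
  ultimately show ?thesis by blast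
qed

end
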